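(* Let $k\geq 2$ be an integer. If $G$ is a non-complete graph of order $n$ with $\sigma_{2}(G)\geq n-2+2\log_{k} n$, then $rc(G)\leq k$.
   Context: All graphs are finite, undirected and simple; the order of a graph is its number of vertices; $\log_b$ denotes the logarithm to base $b$. A graph is non-complete if it has two distinct non-adjacent vertices. For a non-complete graph $G$, the minimum degree-sum is $\sigma_2(G)=\min\{d(u)+d(v) : u,v\in V(G),\ u\neq v,\ uv\notin E(G)\}$, where $d(u)$ is the degree of $u$. An edge-coloring of $G$ is a function from its edge set to the natural numbers (adjacent edges may receive the same color). An edge-colored graph is rainbow connected if every two distinct vertices are joined by a path whose edges have pairwise distinct colors. The rainbow connection number $rc(G)$ of a connected graph $G$ is the smallest number of colors needed in an edge-coloring that makes $G$ rainbow connected. Thus $rc(G)\leq k$ means that there is an edge-coloring of $G$ with at most $k$ colors making $G$ rainbow connected. *)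

theory Defs
  imports
    Complex_Main
    "HOL-Library.Extended_Nat"
    "Graph_Theory.Pair_Digraph"
    "Graph_Theory.Vertex_Walk"
begin

text \<open>
  Finite simple graphs are rendered by the locale \<open>pair_graph\<close>: finite, loop-free, symmetric
  digraphs without parallel arcs.  An undirected edge is represented by the two opposite arcs
  \<open>(u, v)\<close> and \<open>(v, u)\<close>; the degree of a vertex is its \<open>out_degree\<close>.
\<close>

definition non_complete :: "'a pair_pre_digraph \<Rightarrow> bool" where
  "non_complete G \<longleftrightarrow>
     (\<exists>u \<in> pverts G. \<exists>v \<in> pverts G. u \<noteq> v \<and> (u, v) \<notin> parcs G)"

text \<open>Only meaningful for finite non-complete graphs, where the set below is finite and nonempty.\<close>

definition min_degree_sum :: "'a pair_pre_digraph \<Rightarrow> nat" where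
  "min_degree_sum G =
     Min {out_degree G u + out_degree G v | u v.
            u \<in> pverts G \<and> v \<in> pverts G \<and> u \<noteq> v \<and> (u, v) \<notin> parcs G}"

definition undirected_edges :: "'a pair_pre_digraph \<Rightarrow> 'a set set" where
  "undirected_edges G = {{u, v} | u v. (u, v) \<in> parcs G}"

text \<open>
  Edge-colorings assign a color to the undirected edge \<open>{u, v}\<close>, so that both arcs have the same
  color.  They are total functions, but only their values on \<^term>\<open>undirected_edges G\<close> matter.
\<close>

type_synonym 'a edge_coloring = "'a set \<Rightarrow> nat"

definition rainbow_path ::
    "'a pair_pre_digraph \<Rightarrow> 'a edge_coloring \<Rightarrow> 'a \<Rightarrow> 'a vwalk \<Rightarrow> 'a \<Rightarrow> bool" where
  "rainbow_path G c u p v \<longleftrightarrow>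
     vpath p (with_proj G) \<and> hd p = u \<and> last p = v \<and>
     distinct (map (\<lambda>(x, y). c {x, y}) (vwalk_arcs p))"

definition rainbow_connected :: "'a pair_pre_digraph \<Rightarrow> 'a edge_coloring \<Rightarrow> bool" where
  "rainbow_connected G c \<longleftrightarrow>
     (\<forall>u \<in> pverts G. \<forall>v \<in> pverts G. u \<noteq> v \<longrightarrow> (\<exists>p. rainbow_path G c u p v))"

text \<open>
  The value is \<open>\<infinity>\<close> when no edge-coloring makes \<open>G\<close> rainbow connected, i.e. when \<open>G\<close> is
  disconnected; hence a finite bound on it includes the connectedness of \<open>G\<close>.
\<close>

definition rainbow_connection_number :: "'a pair_pre_digraph \<Rightarrow> enat" where
  "rainbow_connection_number G =
     Inf {enat (card (c ` undirected_edges G)) | c. rainbow_connected G c}"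

end

theory Submission
  imports Defs "HOL-Library.FuncSet"
begin

text \<open>
  The proof is a union bound over random colorings, phrased as counting.  Two distinct
  non-adjacent vertices \<open>u\<close>, \<open>v\<close> have all their neighbors among the other \<open>n - 2\<close> vertices, so
  the degree condition forces at least \<open>2 * log k n\<close> common neighbors
  (\<open>degree_sum_le_common_neighbors\<close>).  Each common neighbor \<open>w\<close> gives a path \<open>u, w, v\<close>, and these
  paths are pairwise edge-disjoint.  Under a uniformly random coloring with \<open>k\<close> colors each of them
  is monochromatic with probability \<open>1 / k\<close>, independently of the others, so all of them are
  monochromatic with probability at most \<open>k powr (- 2 * log k n) = 1 / n\<^sup>2\<close>
  (\<open>card_colorings_equal_on_pairs\<close>).  There are fewer than \<open>n\<^sup>2\<close> ordered non-adjacent pairs, hence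
  some coloring gives every one of them a two-edge path with two different colors
  (\<open>union_bound_avoid\<close>).  Adjacent vertices are joined by a single edge, which is always rainbow.
\<close>

section \<open>Counting colorings\<close>

text \<open>
  The color of \<open>f w\<close> is determined by that of \<open>g w\<close>, so such a coloring is known once it is known
  outside \<open>f ` W\<close>; each \<open>w\<close> thus costs a factor \<open>k\<close>.
\<close>

lemma card_colorings_equal_on_pairs:
  fixes k :: nat
  assumes "finite E" and f: "f ` W \<subseteq> E" "inj_on f W"
    and g: "g ` W \<subseteq> E" and disj: "f ` W \<inter> g ` W = {}"
  shows "card {c \<in> E \<rightarrow>\<^sub>E {..<k}. \<forall>w\<in>W. c (f w) = c (g w)} * k ^ card W \<le> k ^ card E"
proof -
  let ?B = "{c \<in> E \<rightarrow>\<^sub>E {..<k}. \<forall>w\<in>W. c (f w) = c (g w)}"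
  let ?R = "E - f ` W"
  have "inj_on (\<lambda>c. restrict c ?R) ?B"
  proof (rule inj_onI)
    fix c d assume c: "c \<in> ?B" and d: "d \<in> ?B" and "restrict c ?R = restrict d ?R"
    then have off: "c e = d e" if "e \<in> ?R" for e
      using that by (metis restrict_apply')
    show "c = d"
    proof (rule PiE_ext)
      show "c \<in> E \<rightarrow>\<^sub>E {..<k}" "d \<in> E \<rightarrow>\<^sub>E {..<k}" using c d by auto
      fix e assume "e \<in> E"
      show "c e = d e"
      proof (cases "e \<in> f ` W")
        case True
        then obtain w where w: "w \<in> W" "e = f w" by blast
        then have "g w \<in> ?R" using g disj by auto
        then show ?thesis using w c d off by simp
      qed (use off \<open>e \<in> E\<close> in simp)
    qed
  qed
  moreover have "(\<lambda>c. restrict c ?R) ` ?B \<subseteq> ?R \<rightarrow>\<^sub>E {..<k}"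
    by fastforce
  moreover have "finite (?R \<rightarrow>\<^sub>E {..<k})"
    using \<open>finite E\<close> by (auto intro: finite_PiE)
  ultimately have "card ?B \<le> card (?R \<rightarrow>\<^sub>E {..<k})"
    by (rule card_inj_on_le)
  also have "\<dots> = k ^ card ?R"
    using \<open>finite E\<close> by (simp add: card_PiE)
  finally have "card ?B * k ^ card W \<le> k ^ (card ?R + card W)"
    by (simp add: power_add)
  also have "card ?R + card W = card E"
    using assms(1) f card_mono[OF \<open>finite E\<close> f(1)]
    by (simp add: card_Diff_subset finite_subset card_image)
  finally show ?thesis .
qed

lemma union_bound_avoid:
  fixes N :: nat
  assumes "finite \<Omega>" "\<Omega> \<noteq> {}" "finite P" "card P < N"
    and small: "\<And>p. p \<in> P \<Longrightarrow> card {x \<in> \<Omega>. bad p x} * N \<le> card \<Omega>"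
  shows "\<exists>x\<in>\<Omega>. \<forall>p\<in>P. \<not> bad p x"
proof (rule ccontr)
  assume "\<not> (\<exists>x\<in>\<Omega>. \<forall>p\<in>P. \<not> bad p x)"
  then have "\<Omega> = (\<Union>p\<in>P. {x \<in> \<Omega>. bad p x})" by auto
  then have "card \<Omega> \<le> (\<Sum>p\<in>P. card {x \<in> \<Omega>. bad p x})"
    using card_UN_le[OF \<open>finite P\<close>, of "\<lambda>p. {x \<in> \<Omega>. bad p x}"] by simp
  then have "card \<Omega> * N \<le> (\<Sum>p\<in>P. card {x \<in> \<Omega>. bad p x} * N)"
    by (simp add: sum_distrib_right[symmetric])
  also have "\<dots> \<le> card P * card \<Omega>"
    using sum_bounded_above[OF small, of P] by simp
  finally have "N \<le> card P"
    using assms(1,2) by (simp add: mult.commute card_gt_0_iff)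
  then show False using \<open>card P < N\<close> by simp
qed

section \<open>Common neighbors and rainbow paths\<close>

context pair_graph
begin

definition common_neighbors :: "'a \<Rightarrow> 'a \<Rightarrow> 'a set" where
  "common_neighbors u v = {w. (u, w) \<in> parcs G \<and> (w, v) \<in> parcs G}"

lemma out_degree_eq_card_neighbors: "out_degree G u = card {w. (u, w) \<in> parcs G}"
proof -
  have "out_arcs G u = Pair u ` {w. (u, w) \<in> parcs G}"
    by (auto simp: out_arcs_def)
  then show ?thesis
    by (simp add: out_degree_def card_image inj_on_def)
qed

text \<open>
  By inclusion-exclusion the degree sum is the size of the union of the two neighborhoods plus
  that of their intersection, and the union contains neither \<open>u\<close> nor \<open>v\<close>.
\<close>

lemma degree_sum_le_common_neighbors:
  assumes "u \<in> pverts G" "v \<in> pverts G" "u \<noteq> v" "(u, v) \<notin> parcs G"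
  shows "out_degree G u + out_degree G v + 2 \<le> card (pverts G) + card (common_neighbors u v)"
proof -
  let ?N = "\<lambda>x. {w. (x, w) \<in> parcs G}"
  have sub: "?N x \<subseteq> pverts G" for x using in_arcsD2 by auto
  then have fin: "finite (?N x)" for x using pair_finite_verts finite_subset by blast
  have int: "?N u \<inter> ?N v = common_neighbors u v"
    unfolding common_neighbors_def using arcs_symmetric by blast
  have "u \<notin> ?N u" "v \<notin> ?N v" "v \<notin> ?N u" "u \<notin> ?N v"
    using no_loops' arcs_symmetric assms by blast+
  then have "?N u \<union> ?N v \<subseteq> pverts G - {u, v}" using sub by blast
  then have "card (?N u \<union> ?N v) \<le> card (pverts G - {u, v})"
    using pair_finite_verts by (intro card_mono) auto
  also have "\<dots> = card (pverts G) - 2"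
    using assms by (simp add: card_Diff_subset)
  finally have "card (?N u \<union> ?N v) + 2 \<le> card (pverts G)"
    using card_mono[of "pverts G" "{u, v}"] assms pair_finite_verts by auto
  then show ?thesis
    using card_Un_Int[OF fin[of u] fin[of v]]
    by (simp add: out_degree_eq_card_neighbors int)
qed

lemma finite_undirected_edges: "finite (undirected_edges G)"
proof -
  have "undirected_edges G = (\<lambda>(u, v). {u, v}) ` parcs G"
    by (auto simp: undirected_edges_def)
  then show ?thesis using pair_finite_arcs by simp
qed

lemma min_degree_sum_le:
  assumes "u \<in> pverts G" "v \<in> pverts G" "u \<noteq> v" "(u, v) \<notin> parcs G"
  shows "min_degree_sum G \<le> out_degree G u + out_degree G v"
  unfolding min_degree_sum_def
proof (rule Min_le)
  let ?S = "{out_degree G u + out_degree G v | u v.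
    u \<in> pverts G \<and> v \<in> pverts G \<and> u \<noteq> v \<and> (u, v) \<notin> parcs G}"
  have "?S \<subseteq> (\<lambda>(u, v). out_degree G u + out_degree G v) ` (pverts G \<times> pverts G)"
    by auto
  then show "finite ?S"
    using pair_finite_verts by (meson finite_SigmaI finite_imageI finite_subset)
qed (use assms in blast)

lemma rainbow_connectedI_common_neighbors:
  assumes "\<And>u v. u \<in> pverts G \<Longrightarrow> v \<in> pverts G \<Longrightarrow> u \<noteq> v \<Longrightarrow> (u, v) \<notin> parcs G \<Longrightarrow>
    \<exists>w\<in>common_neighbors u v. c {u, w} \<noteq> c {w, v}"
  shows "rainbow_connected G c"
  unfolding rainbow_connected_def
proof (intro ballI impI)
  fix u v assume uv: "u \<in> pverts G" "v \<in> pverts G" "u \<noteq> v"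
  show "\<exists>p. rainbow_path G c u p v"
  proof (cases "(u, v) \<in> parcs G")
    case True
    then have "rainbow_path G c u [u, v] v"
      using uv by (auto simp: rainbow_path_def vpath_def vwalk_def)
    then show ?thesis ..
  next
    case False
    then obtain w where w: "(u, w) \<in> parcs G" "(w, v) \<in> parcs G" "c {u, w} \<noteq> c {w, v}"
      using assms uv by (auto simp: common_neighbors_def)
    then have "rainbow_path G c u [u, w, v] v"
      using uv in_arcsD2[OF w(1)] no_loops'[OF w(1)] no_loops'[OF w(2)]
      by (auto simp: rainbow_path_def vpath_def vwalk_def)
    then show ?thesis ..
  qed
qed

text \<open>
  The union bound over all non-adjacent pairs: the hypothesis says that \<open>k ^ - m\<close>, the proportion
  of colorings that fail for one pair with \<open>m\<close> common neighbors, is at most \<open>1 / n\<^sup>2\<close>.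
\<close>

lemma rainbow_coloring_exists:
  fixes k :: nat
  assumes "k > 0" and "pverts G \<noteq> {}"
    and many: "\<And>u v. u \<in> pverts G \<Longrightarrow> v \<in> pverts G \<Longrightarrow> u \<noteq> v \<Longrightarrow> (u, v) \<notin> parcs G \<Longrightarrow>
      (card (pverts G))\<^sup>2 \<le> k ^ card (common_neighbors u v)"
  obtains c where "c ` undirected_edges G \<subseteq> {..<k}" "rainbow_connected G c"
proof -
  let ?V = "pverts G" and ?E = "undirected_edges G"
  let ?\<Omega> = "?E \<rightarrow>\<^sub>E {..<k}"
  let ?P = "{(u, v) \<in> ?V \<times> ?V. u \<noteq> v \<and> (u, v) \<notin> parcs G}"
  let ?bad = "\<lambda>(u, v) c. \<forall>w\<in>common_neighbors u v. c {u, w} = c {w, v}"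
  have card_\<Omega>: "card ?\<Omega> = k ^ card ?E"
    using finite_undirected_edges by (simp add: card_PiE)
  have "finite ?\<Omega>" using finite_undirected_edges by (auto intro: finite_PiE)
  moreover have "?\<Omega> \<noteq> {}" using \<open>k > 0\<close> by (auto simp: PiE_eq_empty_iff)
  moreover have fin: "finite (?V \<times> ?V)" using pair_finite_verts by simp
  then have "finite ?P" by (rule rev_finite_subset) auto
  (* Diagonal pairs are not in ?P, which makes the inequality strict. *)
  moreover have "card ?P < (card ?V)\<^sup>2"
  proof -
    have "?P \<subset> ?V \<times> ?V" using \<open>?V \<noteq> {}\<close> by auto
    then have "card ?P < card (?V \<times> ?V)" by (rule psubset_card_mono[OF fin])
    then show ?thesis by (simp add: card_cartesian_product power2_eq_square)
  qed
  moreover have "card {c \<in> ?\<Omega>. ?bad p c} * (card ?V)\<^sup>2 \<le> card ?\<Omega>" if "p \<in> ?P" for p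
  proof -
    obtain u v where p: "p = (u, v)" by (cases p)
    then have uv: "u \<in> ?V" "v \<in> ?V" "u \<noteq> v" "(u, v) \<notin> parcs G"
      using that by auto
    let ?W = "common_neighbors u v"
    have "card {c \<in> ?\<Omega>. ?bad p c} * (card ?V)\<^sup>2 \<le> card {c \<in> ?\<Omega>. ?bad p c} * k ^ card ?W"
      using many[OF uv] by simp
    also have "\<dots> \<le> k ^ card ?E"
      unfolding p prod.case
    proof (rule card_colorings_equal_on_pairs[OF finite_undirected_edges])
      show "(\<lambda>w. {u, w}) ` ?W \<subseteq> ?E" "(\<lambda>w. {w, v}) ` ?W \<subseteq> ?E"
        by (auto simp: common_neighbors_def undirected_edges_def)
      show "inj_on (\<lambda>w. {u, w}) ?W"
        by (auto simp: inj_on_def doubleton_eq_iff)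
      (* {u, x} = {y, v} with u \<noteq> v would make u = y a neighbor of itself. *)
      show "(\<lambda>w. {u, w}) ` ?W \<inter> (\<lambda>w. {w, v}) ` ?W = {}"
        using uv no_loops' by (auto simp: common_neighbors_def doubleton_eq_iff)
    qed
    finally show ?thesis unfolding card_\<Omega> .
  qed
  ultimately have "\<exists>c\<in>?\<Omega>. \<forall>p\<in>?P. \<not> ?bad p c"
    by (rule union_bound_avoid)
  then obtain c where c: "c \<in> ?\<Omega>" and good: "\<forall>p\<in>?P. \<not> ?bad p c" ..
  have "rainbow_connected G c"
  proof (rule rainbow_connectedI_common_neighbors)
    fix u v assume "u \<in> ?V" "v \<in> ?V" "u \<noteq> v" "(u, v) \<notin> parcs G"
    then show "\<exists>w\<in>common_neighbors u v. c {u, w} \<noteq> c {w, v}"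
      using good by fast
  qed
  moreover have "c ` ?E \<subseteq> {..<k}" using c by auto
  ultimately show thesis using that by blast
qed

end

lemma rainbow_connection_number_le:
  assumes "rainbow_connected G c" "c ` undirected_edges G \<subseteq> {..<k}"
  shows "rainbow_connection_number G \<le> enat k"
proof -
  have "rainbow_connection_number G \<le> enat (card (c ` undirected_edges G))"
    unfolding rainbow_connection_number_def using assms(1) by (intro Inf_lower) blast
  also have "card (c ` undirected_edges G) \<le> k"
    using card_mono[OF _ assms(2)] by simp
  finally show ?thesis by simp
qed

section \<open>The degree-sum condition\<close>

theorem theorem1p4:
  fixes G :: "'a pair_pre_digraph" and k n :: nat
  assumes "k \<ge> 2"
    and "pair_graph G"
    and "non_complete G"
    and "n = card (pverts G)"
    and "real (min_degree_sum G) \<ge> real n - 2 + 2 * log (real k) (real n)"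
  shows "rainbow_connection_number G \<le> enat k"
proof -
  interpret pair_graph G by fact
  have nonempty: "pverts G \<noteq> {}"
    using \<open>non_complete G\<close> by (auto simp: non_complete_def)
  then have "n > 0"
    using assms(4) pair_finite_verts by (simp add: card_gt_0_iff)
  have "(card (pverts G))\<^sup>2 \<le> k ^ card (common_neighbors u v)"
    if uv: "u \<in> pverts G" "v \<in> pverts G" "u \<noteq> v" "(u, v) \<notin> parcs G" for u v
  proof -
    let ?m = "card (common_neighbors u v)"
    have "min_degree_sum G + 2 \<le> n + ?m"
      using min_degree_sum_le[OF uv] degree_sum_le_common_neighbors[OF uv] assms(4) by linarith
    then have "real (min_degree_sum G) + 2 \<le> real n + real ?m"
      by linarith
    then have "2 * log (real k) (real n) \<le> real ?m"
      using assms(5) by linarith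
    then have "log (real k) (real n ^ 2) \<le> real ?m"
      using \<open>n > 0\<close> by (simp add: log_nat_power)
    then have "real n ^ 2 \<le> real k powr real ?m"
      using \<open>n > 0\<close> \<open>k \<ge> 2\<close> by (simp add: log_le_iff)
    also have "\<dots> = real k ^ ?m"
      using \<open>k \<ge> 2\<close> by (simp add: powr_realpow)
    finally show ?thesis
      using assms(4) by (simp flip: of_nat_power)
  qed
  then obtain c where "c ` undirected_edges G \<subseteq> {..<k}" "rainbow_connected G c"
    using rainbow_coloring_exists[of k] nonempty \<open>k \<ge> 2\<close> by auto
  then show ?thesis by (intro rainbow_connection_number_le)
qed

end
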